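(* Let $n\geq 1$ and let $\mathcal{L}$ be any subposet of the partition lattice $\Pi([n])$ containing the minimal element $\hat 0=1|2|\cdots|n$ and the maximal element $\hat 1=[n]$. Let $\Sigma_n\subset\mathbb{P}^{2^n-1}$ be the Segre embedding of $(\mathbb{P}^1)^n$. Then the $\mathcal{L}$-cumulant Cremona transformation $\psi_{\mathcal{L}}\colon \mathbb{P}^{2^n-1}\dashrightarrow\mathbb{P}^{2^n-1}$ linearizes $\Sigma_n$, i.e. it maps $\Sigma_n$ birationally onto a linear subspace. The image of $\Sigma_n$ is the linear space $\{y_I=0 \text{ for all } I\subseteq[n] \text{ with } |I|\geq 2\}$.
   Context: Everything is over $\mathbb{C}$. $[n]=\{1,\ldots,n\}$. For $I\subseteq[n]$ nonempty, $\Pi(I)$ is the set of all set partitions of $I$ into nonempty unordered disjoint blocks, ordered by refinement: $\pi<\nu$ if $\pi$ refines $\nu$; $|\pi|$ is the number of blocks of $\pi$, and $B\in\pi$ means that $B$ is a block of $\pi$. A subposet of $\Pi([n])$ is a subset with the induced order. For $\emptyset\neq I\subseteq[n]$, $\mathcal{L}(I)$ is the subposet of $\Pi(I)$ consisting of the restrictions to $I$ of all partitions in $\mathcal{L}$ (the restriction of $\pi$ to $I$ has as blocks the nonempty sets $B\cap I$, $B\in \pi$). Its maximal element is $\hat 1=I$ (the one-block partition). The Möbius function $\mu$ of $\mathcal{L}(I)$ is defined by $\mu(\pi,\pi)=1$, $\mu(\pi,\nu)=0$ if $\pi\not\leq\nu$, and $\mu(\pi,\nu)=-\sum_{\pi\leq\delta<\nu}\mu(\pi,\delta)$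 for $\pi<\nu$, where $\delta$ runs over $\mathcal{L}(I)$. Let $[x_I]_{I\subseteq[n]}$ and $[y_I]_{I\subseteq[n]}$ be homogeneous coordinates on two copies of $\mathbb{P}^{2^n-1}$. The map $\psi_{\mathcal{L}}\colon[x_I]\mapsto[y_I]$ is defined by $$y_\emptyset=x_\emptyset^n,\qquad y_I=\sum_{\pi\in\mathcal{L}(I)}\mu(\pi,\hat 1)\,x_\emptyset^{n-|\pi|}\prod_{B\in\pi}x_B\quad\text{for }\emptyset\neq I\subseteq[n].$$ It is a Cremona transformation (a birational self-map of projective space). The Segre variety $\Sigma_n$ is the image of $(\mathbb{P}^1)^n$, with coordinates $[a_{i0},a_{i1}]$ on the $i$-th factor, under the map sending $(a_1,\ldots,a_n)$ to the point whose $I$-th coordinate is $\prod_{i\in I}a_{i1}\prod_{i\notin I}a_{i0}$. The image of a variety under a rational map, defined at its general point, means the Zariski closure of the image of the open subset where the map is defined. *)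

theory Defs
  imports "HOL-Analysis.Analysis" "HOL-Library.Disjoint_Sets"
begin

section \<open>Projective space, Zariski topology, rational maps\<close>

text \<open>The coordinates of a projective space are indexed by a finite set \<open>J\<close>. A coordinate vector
  is a function vanishing outside \<open>J\<close>, and a point is the set of all nonzero multiples of a nonzero
  coordinate vector.\<close>

definition coord_vecs :: "'i set \<Rightarrow> ('i \<Rightarrow> complex) set" where
  "coord_vecs J = {x. \<forall>i. i \<notin> J \<longrightarrow> x i = 0}"

definition ppoint :: "('i \<Rightarrow> complex) \<Rightarrow> ('i \<Rightarrow> complex) set" where
  "ppoint x = {(\<lambda>i. c * x i) |c. c \<noteq> 0}"

definition pspace :: "'i set \<Rightarrow> ('i \<Rightarrow> complex) set set" where
  "pspace J = ppoint ` {x \<in> coord_vecs J. x \<noteq> (\<lambda>_. 0)}"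

text \<open>Exponent vectors of degree \<open>d\<close>, and homogeneous polynomials of degree \<open>d\<close> in the variables
  indexed by \<open>J\<close>. As the field is infinite, polynomials are identified with the functions they
  define. The zero polynomial is a form of every degree.\<close>

definition exponents :: "'i set \<Rightarrow> nat \<Rightarrow> ('i \<Rightarrow> nat) set" where
  "exponents J d = {m. (\<forall>i. i \<notin> J \<longrightarrow> m i = 0) \<and> (\<Sum>i\<in>J. m i) = d}"

definition hom_poly :: "'i set \<Rightarrow> nat \<Rightarrow> (('i \<Rightarrow> complex) \<Rightarrow> complex) \<Rightarrow> bool" where
  "hom_poly J d f \<longleftrightarrow> (\<exists>c. f = (\<lambda>x. \<Sum>m\<in>exponents J d. c m * (\<Prod>i\<in>J. x i ^ m i)))"

text \<open>The Zariski topology is generated by the complements of hypersurfaces, so that its closed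
  sets are the common zero loci of sets of homogeneous polynomials. The degree 0 form 1 makes the
  whole space open.\<close>

definition zariski :: "'i set \<Rightarrow> ('i \<Rightarrow> complex) set topology" where
  "zariski J = topology_generated_by
     {{p \<in> pspace J. \<forall>x\<in>p. f x \<noteq> 0} |f. \<exists>d. hom_poly J d f}"

definition dense_open_in :: "'i set \<Rightarrow> ('i \<Rightarrow> complex) set set \<Rightarrow> ('i \<Rightarrow> complex) set set \<Rightarrow> bool" where
  "dense_open_in J X U \<longleftrightarrow>
     openin (subtopology (zariski J) X) U \<and> X \<subseteq> zariski J closure_of U"

definition linear_subspace :: "'i set \<Rightarrow> ('i \<Rightarrow> complex) set set \<Rightarrow> bool" where
  "linear_subspace J W \<longleftrightarrow>
     (\<exists>P. (\<forall>f\<in>P. hom_poly J 1 f) \<and> W = {p \<in> pspace J. \<forall>f\<in>P. \<forall>x\<in>p. f x = 0})"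

text \<open>Tuples, indexed by \<open>K\<close>, of forms of one common degree in the coordinates indexed by \<open>J\<close>;
  the induced map on points; and the points of \<open>X\<close> at which the tuple does not vanish.\<close>

definition hom_tuple ::
  "'i set \<Rightarrow> 'k set \<Rightarrow> (('i \<Rightarrow> complex) \<Rightarrow> ('k \<Rightarrow> complex)) \<Rightarrow> bool" where
  "hom_tuple J K F \<longleftrightarrow>
     (\<exists>d. \<forall>k\<in>K. hom_poly J d (\<lambda>x. F x k)) \<and> (\<forall>x. F x \<in> coord_vecs K)"

definition pmap ::
  "(('i \<Rightarrow> complex) \<Rightarrow> ('k \<Rightarrow> complex)) \<Rightarrow> ('i \<Rightarrow> complex) set \<Rightarrow> ('k \<Rightarrow> complex) set" where
  "pmap F p = (\<Union>x\<in>p. ppoint (F x))"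

definition nonvanishing ::
  "(('i \<Rightarrow> complex) \<Rightarrow> ('k \<Rightarrow> complex)) \<Rightarrow> ('i \<Rightarrow> complex) set set \<Rightarrow> ('i \<Rightarrow> complex) set set" where
  "nonvanishing F X = {p \<in> X. \<forall>x\<in>p. F x \<noteq> (\<lambda>_. 0)}"

text \<open>\<open>F\<close> defines a rational map on \<open>X\<close>: it is defined at the general point of \<open>X\<close>.\<close>

definition rational_map_on ::
  "'i set \<Rightarrow> 'k set \<Rightarrow> (('i \<Rightarrow> complex) \<Rightarrow> ('k \<Rightarrow> complex)) \<Rightarrow> ('i \<Rightarrow> complex) set set \<Rightarrow> bool" where
  "rational_map_on J K F X \<longleftrightarrow> hom_tuple J K F \<and> dense_open_in J X (nonvanishing F X)"

text \<open>The rational map on \<open>X\<close> given by \<open>F\<close> is defined at \<open>p\<close> as soon as some tuple \<open>G\<close>,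
  proportional to \<open>F\<close> along \<open>X\<close>, does not vanish at \<open>p\<close>; its value there is then given by \<open>G\<close>.
  So the domain of definition can be larger than \<open>nonvanishing F X\<close>.\<close>

definition represents_at ::
  "'i set \<Rightarrow> 'k set \<Rightarrow> (('i \<Rightarrow> complex) \<Rightarrow> ('k \<Rightarrow> complex)) \<Rightarrow> ('i \<Rightarrow> complex) set set
    \<Rightarrow> ('i \<Rightarrow> complex) set \<Rightarrow> (('i \<Rightarrow> complex) \<Rightarrow> ('k \<Rightarrow> complex)) \<Rightarrow> bool" where
  "represents_at J K F X p G \<longleftrightarrow>
     hom_tuple J K G \<and> p \<in> nonvanishing G X \<and>
     (\<forall>q\<in>X. \<forall>x\<in>q. \<forall>i\<in>K. \<forall>j\<in>K. F x i * G x j = F x j * G x i)"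

definition rational_image ::
  "'i set \<Rightarrow> 'k set \<Rightarrow> (('i \<Rightarrow> complex) \<Rightarrow> ('k \<Rightarrow> complex)) \<Rightarrow> ('i \<Rightarrow> complex) set set
    \<Rightarrow> ('k \<Rightarrow> complex) set set" where
  "rational_image J K F X =
     zariski K closure_of {pmap G p |G p. p \<in> X \<and> represents_at J K F X p G}"

text \<open>\<open>F\<close> maps \<open>X\<close> birationally onto \<open>Y\<close>: its restriction to \<open>X\<close> has a rational inverse, that is, \<open>F\<close>
  and some tuple \<open>G\<close> induce mutually inverse maps between dense open subsets of \<open>X\<close> and \<open>Y\<close>.
  (For irreducible \<open>X\<close> and \<open>Y\<close>, dense open means nonempty open.)\<close>

definition birational_onto ::
  "'i set \<Rightarrow> 'k set \<Rightarrow> (('i \<Rightarrow> complex) \<Rightarrow> ('k \<Rightarrow> complex)) \<Rightarrow> ('i \<Rightarrow> complex) set set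
    \<Rightarrow> ('k \<Rightarrow> complex) set set \<Rightarrow> bool" where
  "birational_onto J K F X Y \<longleftrightarrow>
     rational_map_on J K F X \<and>
     (\<exists>G U V. rational_map_on K J G Y \<and>
        dense_open_in J X U \<and> U \<subseteq> nonvanishing F X \<and>
        dense_open_in K Y V \<and> V \<subseteq> nonvanishing G Y \<and>
        pmap F ` U \<subseteq> V \<and> pmap G ` V \<subseteq> U \<and>
        (\<forall>p\<in>U. pmap G (pmap F p) = p) \<and> (\<forall>q\<in>V. pmap F (pmap G q) = q))"

definition linearizes ::
  "'i set \<Rightarrow> (('i \<Rightarrow> complex) \<Rightarrow> ('i \<Rightarrow> complex)) \<Rightarrow> ('i \<Rightarrow> complex) set set \<Rightarrow> bool" where
  "linearizes J F X \<longleftrightarrow> (\<exists>W. linear_subspace J W \<and> birational_onto J J F X W)"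

section \<open>Partitions and cumulants\<close>

definition partitions :: "'a set \<Rightarrow> 'a set set set" where
  "partitions I = {\<pi>. partition_on I \<pi>}"

definition restrict_partition :: "'a set \<Rightarrow> 'a set set \<Rightarrow> 'a set set" where
  "restrict_partition I \<pi> = (\<inter>) I ` \<pi> - {{}}"

definition restrict_poset :: "'a set set set \<Rightarrow> 'a set \<Rightarrow> 'a set set set" where
  "restrict_poset L I = restrict_partition I ` L"

text \<open>The Moebius function of a subposet \<open>Q\<close> of the lattice of partitions of \<open>I\<close>, ordered by
  refinement. Finiteness of \<open>I\<close> is tested only to ensure termination.\<close>

function moebius :: "'a set \<Rightarrow> 'a set set set \<Rightarrow> 'a set set \<Rightarrow> 'a set set \<Rightarrow> int" where
  "moebius I Q \<pi> \<nu> =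
     (if \<pi> = \<nu> then 1
      else if finite I \<and> refines I \<pi> \<nu>
        then - (\<Sum>\<delta>\<in>{\<delta> \<in> Q. refines I \<pi> \<delta> \<and> refines I \<delta> \<nu> \<and> \<delta> \<noteq> \<nu>}. moebius I Q \<pi> \<delta>)
      else 0)"
  by pat_completeness auto
termination
proof (relation "Wellfounded.measure (\<lambda>(I, Q, \<pi>, \<nu>). card {\<xi>. refines I \<xi> \<nu>})", goal_cases)
  case 1
  show ?case by simp
next
  case (2 I Q \<pi> \<nu> \<delta>)
  then have r: "refines I \<delta> \<nu>" and ne: "\<delta> \<noteq> \<nu>" and fin: "finite I"
    by auto
  have "{\<xi>. refines I \<xi> \<nu>} \<subseteq> Pow (Pow I)"
    by (auto simp: refines_def partition_on_def)
  then have fin': "finite {\<xi>. refines I \<xi> \<nu>}"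
    using fin by (meson finite_Pow_iff finite_subset)
  have "refines I \<nu> \<nu>"
    using r by (auto simp: refines_def)
  moreover have "\<not> refines I \<nu> \<delta>"
    using refines_asym[OF r] ne by blast
  ultimately have "{\<xi>. refines I \<xi> \<delta>} \<subset> {\<xi>. refines I \<xi> \<nu>}"
    using r refines_trans by blast
  with fin' show ?case
    by (simp add: psubset_card_mono)
qed

declare moebius.simps [simp del]

text \<open>The \<open>\<L>\<close>-cumulant map, on coordinate vectors indexed by the subsets of \<open>{1..n}\<close>.\<close>

definition cumulant_map ::
  "nat \<Rightarrow> nat set set set \<Rightarrow> (nat set \<Rightarrow> complex) \<Rightarrow> (nat set \<Rightarrow> complex)" where
  "cumulant_map n L x = (\<lambda>I.
     if I = {} then x {} ^ n
     else if I \<subseteq> {1..n} then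
       (\<Sum>\<pi>\<in>restrict_poset L I.
          of_int (moebius I (restrict_poset L I) \<pi> {I}) * x {} ^ (n - card \<pi>) * (\<Prod>B\<in>\<pi>. x B))
     else 0)"

definition segre_vec :: "nat \<Rightarrow> (nat \<Rightarrow> nat \<Rightarrow> complex) \<Rightarrow> (nat set \<Rightarrow> complex)" where
  "segre_vec n a = (\<lambda>I.
     if I \<subseteq> {1..n} then (\<Prod>i\<in>I. a i 1) * (\<Prod>i\<in>{1..n} - I. a i 0) else 0)"

definition segre_variety :: "nat \<Rightarrow> (nat set \<Rightarrow> complex) set set" where
  "segre_variety n = {ppoint (segre_vec n a) |a. \<forall>i\<in>{1..n}. (a i 0, a i 1) \<noteq> (0, 0)}"

end

theory Submission
  imports Defs
begin

text \<open>On the chart \<open>x {} = 1\<close> a point of the Segre variety has coordinates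
  \<open>x I = (\<Prod>i\<in>I. z i)\<close>, so the monomial attached to a partition of \<open>I\<close> does not depend on
  the partition, and \<open>y I\<close> is this monomial times \<open>\<Sum>\<pi>. \<mu>(\<pi>, {I})\<close>. As the poset has a least
  element, the sum vanishes when \<open>I\<close> has at least two elements. The map is therefore
  \<open>(\<Prod>i\<in>I. z i) \<mapsto> (1, z 1, \<dots>, z n, 0, \<dots>, 0)\<close> on this chart, with the obvious inverse.\<close>

section \<open>The Moebius function of a poset of partitions\<close>

text \<open>The recursion for \<mu> fixes the lower argument and sums over the upper one, whereas a
  cumulant fixes the upper argument \<open>{I}\<close> and sums over the lower one. The vanishing
  thus rests on a transposed identity: in the incidence algebra of a finite poset, a one-sided
  inverse of the zeta function is two-sided. A second obstacle is that \<open>rational_image\<close>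
  admits every tuple proportional to the cumulant map along the variety, also at points where the
  cumulant map itself vanishes. A computation on the chart alone therefore does not bound the image
  from above; density of the chart carries the equations \<open>y I = 0\<close> over to all these
  tuples. Density in turn comes from sequences converging coordinatewise, along which forms are
  continuous: a point off the chart is reached by making vanishing homogenizing coordinates small
  and nonzero.\<close>

text \<open>With Z the zeta function of the order, the hypothesis reads M * Z = 1 and the conclusion
  Z * M = 1. The product M * Z * M is computed in both bracketings; as \<open>M p p = 1\<close>, its
  value at \<open>(p, q)\<close> can be solved for the sum starting at \<open>p\<close> once the
  sums starting strictly above \<open>p\<close> are known.\<close>

lemma dual_moebius_sum:
  fixes M :: "'b \<Rightarrow> 'b \<Rightarrow> int" and le :: "'b \<Rightarrow> 'b \<Rightarrow> bool"
  assumes fin: "finite Q"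
    and le_refl: "\<And>p. p \<in> Q \<Longrightarrow> le p p"
    and le_antisym: "\<And>p q. le p q \<Longrightarrow> le q p \<Longrightarrow> p = q"
    and le_trans: "\<And>p q r. le p q \<Longrightarrow> le q r \<Longrightarrow> le p r"
    and M: "\<And>p q. p \<in> Q \<Longrightarrow> q \<in> Q \<Longrightarrow> le p q \<Longrightarrow>
      (\<Sum>d\<in>{d \<in> Q. le p d \<and> le d q}. M p d) = (if p = q then 1 else 0)"
    and "p \<in> Q" "q \<in> Q" "le p q"
  shows "(\<Sum>d\<in>{d \<in> Q. le p d \<and> le d q}. M d q) = (if p = q then 1 else 0)"
  using assms(6,8)
proof (induction "card {d \<in> Q. le p d}" arbitrary: p rule: less_induct)
  case less
  define g where "g d = (\<Sum>e\<in>{e \<in> Q. le d e \<and> le e q}. M e q)" for d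
  let ?A = "{d \<in> Q. le p d \<and> le d q}"
  have finA: "finite ?A"
    using fin by simp
  have pA: "p \<in> ?A" and qA: "q \<in> ?A"
    using less.prems le_refl \<open>q \<in> Q\<close> by auto
  have Mpp: "M p p = 1"
  proof -
    have "{d \<in> Q. le p d \<and> le d p} = {p}"
      using less.prems le_refl le_antisym by blast
    then show ?thesis
      using M[of p p] less.prems le_refl by simp
  qed
  have g: "g d = (if d = q then 1 else 0)" if "d \<in> ?A" "d \<noteq> p" for d
    unfolding g_def
  proof (rule less.hyps)
    \<comment> \<open>An element strictly above \<open>p\<close> has fewer elements above it, since
      \<open>p\<close> itself drops out by antisymmetry.\<close>
    have "{e \<in> Q. le d e} \<subset> {e \<in> Q. le p e}"
      using that less.prems le_refl le_antisym le_trans by blast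
    then show "card {e \<in> Q. le d e} < card {e \<in> Q. le p e}"
      using fin by (simp add: psubset_card_mono)
  qed (use that in auto)
  \<comment> \<open>Both sides sum over the pairs \<open>d\<close>, \<open>e\<close> with
    \<open>p\<close>, \<open>d\<close>, \<open>e\<close>, \<open>q\<close> weakly increasing.
    Summing over \<open>d\<close> first leaves only \<open>e = p\<close>, by the hypothesis on
    \<open>M\<close>.\<close>
  have "(\<Sum>d\<in>?A. M p d * g d) = (\<Sum>d\<in>?A. \<Sum>e\<in>{e. e \<in> ?A \<and> le d e}. M p d * M e q)"
    unfolding g_def sum_distrib_left
    by (intro sum.cong refl) (auto intro: le_trans)
  also have "\<dots> = (\<Sum>e\<in>?A. \<Sum>d\<in>{d. d \<in> ?A \<and> le d e}. M p d * M e q)"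
    by (rule sum.swap_restrict[OF finA finA])
  also have "\<dots> = (\<Sum>e\<in>?A. (\<Sum>d\<in>{d \<in> Q. le p d \<and> le d e}. M p d) * M e q)"
    unfolding sum_distrib_right
    by (intro sum.cong refl) (auto intro: le_trans)
  also have "\<dots> = (\<Sum>e\<in>?A. (if p = e then M e q else 0))"
    using M less.prems by (intro sum.cong refl) auto
  also have "\<dots> = M p q"
    using pA finA by simp
  finally have "M p q = (\<Sum>d\<in>?A. M p d * g d)" ..
  also have "\<dots> = M p p * g p + (\<Sum>d\<in>?A - {p}. M p d * g d)"
    by (rule sum.remove[OF finA pA])
  also have "(\<Sum>d\<in>?A - {p}. M p d * g d) = (\<Sum>d\<in>?A - {p}. if d = q then M p d else 0)"
    using g by (intro sum.cong refl) auto
  also have "\<dots> = (if p = q then 0 else M p q)"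
    using finA qA by (auto simp: sum.delta)
  finally show ?case
    using Mpp by (auto simp: g_def split: if_splits)
qed

lemma moebius_refl [simp]: "moebius I Q \<pi> \<pi> = 1"
  by (subst moebius.simps) simp

lemma moebius_sum_upper:
  assumes fin: "finite I" and Q: "Q \<subseteq> partitions I"
    and "\<pi> \<in> Q" "\<nu> \<in> Q" "refines I \<pi> \<nu>"
  shows "(\<Sum>\<delta>\<in>{\<delta> \<in> Q. refines I \<pi> \<delta> \<and> refines I \<delta> \<nu>}. moebius I Q \<delta> \<nu>) = (if \<pi> = \<nu> then 1 else 0)"
proof (rule dual_moebius_sum)
  show finQ: "finite Q"
    using finitely_many_partition_on[OF fin] Q unfolding partitions_def by (rule rev_finite_subset)
  fix \<pi> \<nu> assume *: "\<pi> \<in> Q" "\<nu> \<in> Q" "refines I \<pi> \<nu>"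
  let ?A = "{\<delta> \<in> Q. refines I \<pi> \<delta> \<and> refines I \<delta> \<nu>}"
  have \<nu>: "\<nu> \<in> ?A"
    using * by (auto simp: refines_def)
  have B: "?A - {\<nu>} = {\<delta> \<in> Q. refines I \<pi> \<delta> \<and> refines I \<delta> \<nu> \<and> \<delta> \<noteq> \<nu>}"
    by auto
  show "(\<Sum>\<delta>\<in>?A. moebius I Q \<pi> \<delta>) = (if \<pi> = \<nu> then 1 else 0)"
  proof (cases "\<pi> = \<nu>")
    case True
    then have "?A = {\<nu>}"
      using \<nu> refines_asym by blast
    then show ?thesis using True by simp
  next
    case False
    then have "moebius I Q \<pi> \<nu> = - (\<Sum>\<delta>\<in>?A - {\<nu>}. moebius I Q \<pi> \<delta>)"
      unfolding B using fin * by (subst moebius.simps) simp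
    then show ?thesis
      using False sum.remove[of ?A \<nu> "moebius I Q \<pi>"] finQ \<nu> by simp
  qed
next
  fix \<pi> assume "\<pi> \<in> Q"
  then show "refines I \<pi> \<pi>"
    using Q by (auto simp: partitions_def intro: refines_refl)
next
  fix p q r assume "refines I p q" "refines I q r"
  then show "refines I p r" by (rule refines_trans)
next
  fix p q assume "refines I p q" "refines I q p"
  then show "p = q" by (rule refines_asym)
qed (use assms in auto)

text \<open>The interval from the partition into singletons to \<open>{I}\<close> is all of
  \<open>Q\<close>, and two elements of \<open>I\<close> make its ends distinct, so this is the
  transposed identity for one nontrivial interval.\<close>

lemma moebius_sum_top:
  assumes fin: "finite I" and Q: "Q \<subseteq> partitions I"
    and bot: "(\<lambda>i. {i}) ` I \<in> Q" and top: "{I} \<in> Q" and card: "card I \<ge> 2"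
  shows "(\<Sum>\<pi>\<in>Q. moebius I Q \<pi> {I}) = 0"
proof -
  let ?b = "(\<lambda>i. {i}) ` I"
  have part: "partition_on I \<pi>" if "\<pi> \<in> Q" for \<pi>
    using that Q by (auto simp: partitions_def)
  have *: "refines I ?b \<pi> \<and> refines I \<pi> {I}" if "\<pi> \<in> Q" for \<pi>
    using part[OF that] part[OF bot] part[OF top] by (fastforce simp: refines_def partition_on_def)
  have "I \<notin> ?b"
    using card by auto
  then have "?b \<noteq> {I}"
    by blast
  moreover have "{\<pi> \<in> Q. refines I ?b \<pi> \<and> refines I \<pi> {I}} = Q"
    using * by blast
  ultimately show ?thesis
    using moebius_sum_upper[OF fin Q bot top] * top by simp
qed

section \<open>Restricted posets and blocks of a partition\<close>

lemma restrict_poset_subset: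
  assumes "L \<subseteq> partitions A" "I \<subseteq> A"
  shows "restrict_poset L I \<subseteq> partitions I"
  using assms partition_on_restrict[of A _ I]
  by (fastforce simp: restrict_poset_def restrict_partition_def partitions_def Int_absorb2)

lemma singletons_in_restrict_poset:
  assumes "(\<lambda>i. {i}) ` A \<in> L" "I \<subseteq> A"
  shows "(\<lambda>i. {i}) ` I \<in> restrict_poset L I"
proof -
  have "restrict_partition I ((\<lambda>i. {i}) ` A) = (\<lambda>i. {i}) ` I"
    using assms(2) by (auto simp: restrict_partition_def image_iff)
  then show ?thesis
    using assms(1) unfolding restrict_poset_def by (metis imageI)
qed

lemma top_in_restrict_poset:
  assumes "{A} \<in> L" "I \<subseteq> A" "I \<noteq> {}"
  shows "{I} \<in> restrict_poset L I"
proof -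
  have "restrict_partition I {A} = {I}"
    using assms(2,3) by (auto simp: restrict_partition_def)
  then show ?thesis
    using assms(1) unfolding restrict_poset_def by (metis imageI)
qed

text \<open>Blocks are nonempty and their sizes add up to \<open>card I\<close>. This keeps the
  natural-number subtraction \<open>n - card \<pi>\<close> in \<open>cumulant_map\<close> from being
  truncated.\<close>

lemma card_partition_le:
  assumes "partition_on I \<pi>" "finite I"
  shows "card \<pi> \<le> card I"
proof -
  have "card \<pi> = (\<Sum>B\<in>\<pi>. 1)"
    by simp
  also have "\<dots> \<le> (\<Sum>B\<in>\<pi>. card B)"
  proof (rule sum_mono)
    fix B assume "B \<in> \<pi>"
    then have "B \<noteq> {}" "B \<subseteq> I"
      using assms(1) by (auto simp: partition_on_def)
    then show "1 \<le> card B"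
      using assms(2) by (simp add: Suc_le_eq card_gt_0_iff finite_subset)
  qed
  also have "\<dots> = card I"
    using assms product_partition[of I \<pi>] by (metis Union_upper finite_subset partition_onD1)
  finally show ?thesis .
qed

lemma partition_on_singleton_iff: "partition_on {i} \<pi> \<longleftrightarrow> \<pi> = {{i}}"
proof
  assume p: "partition_on {i} \<pi>"
  then have "B = {i}" if "B \<in> \<pi>" for B
    using that p subset_singletonD[of B i] by (auto simp: partition_on_def)
  moreover have "\<pi> \<noteq> {}"
    using p by (auto simp: partition_on_def)
  ultimately show "\<pi> = {{i}}" by blast
qed (simp add: partition_on_space)

section \<open>Forms and the Zariski topology\<close>

text \<open>Each exponent is at most the total degree \<open>d\<close>. Finiteness matters because a
  sum over an infinite index set is 0, which would make the formula in \<open>hom_poly\<close>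
  degenerate.\<close>

lemma finite_exponents:
  assumes "finite J" shows "finite (exponents J d)"
proof (rule finite_subset)
  show "exponents J d \<subseteq> {m. \<forall>i. (i \<in> J \<longrightarrow> m i \<in> {..d}) \<and> (i \<notin> J \<longrightarrow> m i = 0)}"
    using assms member_le_sum[of _ J] by (fastforce simp: exponents_def)
qed (use assms in \<open>intro finite_set_of_finite_funs\<close>, auto)

lemma hom_poly_monomial:
  assumes "finite J" "m \<in> exponents J d"
  shows "hom_poly J d (\<lambda>x. \<Prod>i\<in>J. x i ^ m i)"
  unfolding hom_poly_def
proof (intro exI[of _ "\<lambda>m'. if m' = m then 1 else 0"] ext)
  fix x :: "'a \<Rightarrow> complex"
  have "(\<Sum>m'\<in>exponents J d. (if m' = m then 1 else 0) * (\<Prod>i\<in>J. x i ^ m' i)) =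
      (\<Sum>m'\<in>exponents J d. if m' = m then (\<Prod>i\<in>J. x i ^ m' i) else 0)"
    by (intro sum.cong) auto
  then show "(\<Prod>i\<in>J. x i ^ m i) =
      (\<Sum>m'\<in>exponents J d. (if m' = m then 1 else 0) * (\<Prod>i\<in>J. x i ^ m' i))"
    using finite_exponents[OF assms(1)] assms(2) by simp
qed

lemma hom_poly_lincomb:
  assumes "\<And>a. a \<in> A \<Longrightarrow> hom_poly J d (f a)"
  shows "hom_poly J d (\<lambda>x. \<Sum>a\<in>A. k a * f a x)"
proof -
  have "\<forall>a\<in>A. \<exists>c. \<forall>x. f a x = (\<Sum>m\<in>exponents J d. c m * (\<Prod>i\<in>J. x i ^ m i))"
    using assms unfolding hom_poly_def by metis
  then obtain c where
    c: "\<And>a x. a \<in> A \<Longrightarrow> f a x = (\<Sum>m\<in>exponents J d. c a m * (\<Prod>i\<in>J. x i ^ m i))"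
    by metis
  have "(\<Sum>a\<in>A. k a * f a x) =
      (\<Sum>m\<in>exponents J d. (\<Sum>a\<in>A. k a * c a m) * (\<Prod>i\<in>J. x i ^ m i))" for x
    by (simp add: c sum_distrib_left sum_distrib_right mult.assoc sum.swap[of _ _ A])
  then show ?thesis
    unfolding hom_poly_def by (intro exI[of _ "\<lambda>m. \<Sum>a\<in>A. k a * c a m"]) auto
qed

lemma hom_poly_one: "finite J \<Longrightarrow> hom_poly J 0 (\<lambda>_. 1)"
  using hom_poly_monomial[of J "\<lambda>_. 0" 0] by (simp add: exponents_def)

text \<open>The common shape of the terms of the cumulant map and of the components of its inverse:
  a power of the coordinate at \<open>{}\<close> times a product of distinct other
  coordinates.\<close>

lemma hom_poly_power_times_prod:
  assumes "finite J" "j \<in> J" "A \<subseteq> J" "j \<notin> A"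
  shows "hom_poly J (k + card A) (\<lambda>x. x j ^ k * (\<Prod>i\<in>A. x i))"
proof -
  define m where "m i = (if i = j then k else if i \<in> A then 1 else 0)" for i
  have fin: "finite A"
    using assms finite_subset by blast
  have sub: "insert j A \<subseteq> J"
    using assms by auto
  have "(\<Sum>i\<in>J. m i) = (\<Sum>i\<in>insert j A. m i)"
    by (rule sum.mono_neutral_right[OF assms(1) sub]) (auto simp: m_def)
  also have "\<dots> = k + (\<Sum>i\<in>A. m i)"
    using assms(4) fin by (simp add: m_def)
  also have "(\<Sum>i\<in>A. m i) = (\<Sum>i\<in>A. 1)"
    using assms(4) by (intro sum.cong) (auto simp: m_def)
  finally have "(\<Sum>i\<in>J. m i) = k + card A"
    by simp
  then have "m \<in> exponents J (k + card A)"
    using assms(2,3) by (auto simp: exponents_def m_def)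
  moreover have "(\<Prod>i\<in>J. x i ^ m i) = x j ^ k * (\<Prod>i\<in>A. x i)" for x :: "'a \<Rightarrow> complex"
  proof -
    have "(\<Prod>i\<in>J. x i ^ m i) = (\<Prod>i\<in>insert j A. x i ^ m i)"
      by (rule prod.mono_neutral_right[OF assms(1) sub]) (auto simp: m_def)
    also have "\<dots> = x j ^ k * (\<Prod>i\<in>A. x i ^ m i)"
      using assms(4) fin by (simp add: m_def)
    also have "(\<Prod>i\<in>A. x i ^ m i) = (\<Prod>i\<in>A. x i)"
      using assms(4) by (intro prod.cong) (auto simp: m_def)
    finally show ?thesis .
  qed
  ultimately show ?thesis
    using hom_poly_monomial[OF assms(1), of m] by simp
qed

lemma hom_poly_coordinate: "finite J \<Longrightarrow> i \<in> J \<Longrightarrow> hom_poly J 1 (\<lambda>x. x i)"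
  using hom_poly_power_times_prod[of J i "{}" 1] by simp

lemma hom_poly_scale:
  assumes "hom_poly J d f"
  shows "f (\<lambda>i. c * x i) = c ^ d * f x"
proof -
  obtain a where f: "f = (\<lambda>x. \<Sum>m\<in>exponents J d. a m * (\<Prod>i\<in>J. x i ^ m i))"
    using assms unfolding hom_poly_def by blast
  have "(\<Prod>i\<in>J. (c * x i) ^ m i) = c ^ d * (\<Prod>i\<in>J. x i ^ m i)" if "m \<in> exponents J d" for m
    using that by (simp add: power_mult_distrib prod.distrib exponents_def flip: power_sum)
  then show ?thesis
    unfolding f sum_distrib_left by (intro sum.cong) (auto simp: algebra_simps)
qed

lemma hom_poly_tendsto:
  assumes "hom_poly J d f" "\<And>i. (\<lambda>k. X k i) \<longlonglongrightarrow> x i"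
  shows "(\<lambda>k. f (X k)) \<longlonglongrightarrow> f x"
proof -
  obtain a where f: "f = (\<lambda>x. \<Sum>m\<in>exponents J d. a m * (\<Prod>i\<in>J. x i ^ m i))"
    using assms(1) unfolding hom_poly_def by blast
  show ?thesis
    unfolding f by (intro tendsto_intros assms(2))
qed

section \<open>Points of projective space and independence of the representative\<close>

lemma ppoint_self: "x \<in> ppoint x"
  unfolding ppoint_def by (rule CollectI, rule exI[of _ 1]) simp

lemma ppoint_scale:
  assumes "c \<noteq> 0" shows "ppoint (\<lambda>i. c * x i) = ppoint x"
proof
  show "ppoint (\<lambda>i. c * x i) \<subseteq> ppoint x"
    using assms unfolding ppoint_def by (force simp flip: mult.assoc)
  show "ppoint x \<subseteq> ppoint (\<lambda>i. c * x i)"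
  proof
    fix y assume "y \<in> ppoint x"
    then obtain b where b: "y = (\<lambda>i. b * x i)" "b \<noteq> 0"
      by (auto simp: ppoint_def)
    then have "y = (\<lambda>i. b / c * (c * x i))" "b / c \<noteq> 0"
      using assms by auto
    then show "y \<in> ppoint (\<lambda>i. c * x i)"
      unfolding ppoint_def by blast
  qed
qed

lemma pspace_ppoint_iff: "ppoint x \<in> pspace J \<longleftrightarrow> x \<in> coord_vecs J \<and> x \<noteq> (\<lambda>_. 0)"
proof
  assume "ppoint x \<in> pspace J"
  then obtain y where y: "ppoint x = ppoint y" "y \<in> coord_vecs J" "y \<noteq> (\<lambda>_. 0)"
    unfolding pspace_def by blast
  then obtain c where "x = (\<lambda>i. c * y i)" "c \<noteq> 0"
    using ppoint_self[of x] by (auto simp: ppoint_def)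
  then show "x \<in> coord_vecs J \<and> x \<noteq> (\<lambda>_. 0)"
    using y by (auto simp: coord_vecs_def fun_eq_iff)
qed (auto simp: pspace_def)

lemma hom_poly_ppoint_nonzero_iff:
  assumes "hom_poly J d f"
  shows "(\<forall>y\<in>ppoint x. f y \<noteq> 0) \<longleftrightarrow> f x \<noteq> 0"
  using hom_poly_scale[OF assms] ppoint_self[of x] by (auto simp: ppoint_def)

lemma ppoint_coordinate_zero_iff: "(\<forall>y\<in>ppoint x. y i = 0) \<longleftrightarrow> x i = 0"
  using ppoint_self[of x] by (auto simp: ppoint_def)

lemma hom_tuple_scale:
  assumes "hom_tuple J K F"
  obtains d where "\<And>c x. F (\<lambda>i. c * x i) = (\<lambda>k. c ^ d * F x k)"
proof -
  obtain d where d: "\<forall>k\<in>K. hom_poly J d (\<lambda>x. F x k)" and F: "\<forall>x. F x \<in> coord_vecs K"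
    using assms unfolding hom_tuple_def by blast
  have "F (\<lambda>i. c * x i) k = c ^ d * F x k" for c x k
  proof (cases "k \<in> K")
    case True
    then show ?thesis
      using d hom_poly_scale[of J d "\<lambda>x. F x k"] by blast
  next
    case False
    then show ?thesis
      using F by (simp add: coord_vecs_def)
  qed
  then show thesis
    using that by blast
qed

lemma ppoint_nonzero_iff:
  assumes "hom_tuple J K F"
  shows "(\<forall>y\<in>ppoint x. F y \<noteq> (\<lambda>_. 0)) \<longleftrightarrow> F x \<noteq> (\<lambda>_. 0)"
proof -
  obtain d where "\<And>c x. F (\<lambda>i. c * x i) = (\<lambda>k. c ^ d * F x k)"
    using hom_tuple_scale[OF assms] by blast
  then have "F (\<lambda>i. c * x i) \<noteq> (\<lambda>_. 0) \<longleftrightarrow> F x \<noteq> (\<lambda>_. 0)" if "c \<noteq> 0" for c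
    using that by (simp add: fun_eq_iff)
  then show ?thesis
    using ppoint_self[of x] by (auto simp: ppoint_def)
qed

text \<open>Another representative multiplies all components by the same nonzero power
  \<open>c ^ d\<close>, so the sets united in \<open>pmap\<close> coincide. Here the common degree
  of the components is essential.\<close>

lemma pmap_ppoint:
  assumes "hom_tuple J K F"
  shows "pmap F (ppoint x) = ppoint (F x)"
proof -
  obtain d where "\<And>c x. F (\<lambda>i. c * x i) = (\<lambda>k. c ^ d * F x k)"
    using hom_tuple_scale[OF assms] by blast
  then have "ppoint (F (\<lambda>i. c * x i)) = ppoint (F x)" if "c \<noteq> 0" for c
    using that by (simp add: ppoint_scale)
  then have "ppoint (F y) = ppoint (F x)" if "y \<in> ppoint x" for y
    using that by (force simp: ppoint_def[of x])
  then show ?thesis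
    unfolding pmap_def using ppoint_self[of x] by blast
qed

section \<open>Open, closed and dense sets in the Zariski topology\<close>

lemma openin_zariski_nonzero:
  assumes "hom_poly J d f"
  shows "openin (zariski J) {p \<in> pspace J. \<forall>x\<in>p. f x \<noteq> 0}"
  unfolding zariski_def by (rule topology_generated_by_Basis) (use assms in blast)

lemma topspace_zariski:
  assumes "finite J" shows "topspace (zariski J) = pspace J"
proof
  show "pspace J \<subseteq> topspace (zariski J)"
    using openin_subset[OF openin_zariski_nonzero[OF hom_poly_one[OF assms]]] by simp
qed (auto simp: zariski_def)

text \<open>Zariski open sets are sequentially open; density arguments thus reduce to perturbing
  coordinates.\<close>

lemma openin_zariski_eventually:
  assumes "openin (zariski J) U" "ppoint x \<in> U"
    and X: "\<And>k. X k \<in> coord_vecs J" "\<And>i. (\<lambda>k. X k i) \<longlonglongrightarrow> x i"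
  shows "eventually (\<lambda>k. ppoint (X k) \<in> U) sequentially"
proof -
  have "generate_topology_on {{p \<in> pspace J. \<forall>x\<in>p. f x \<noteq> 0} |f. \<exists>d. hom_poly J d f} U"
    using assms(1) by (simp add: zariski_def openin_topology_generated_by_iff)
  then show ?thesis
    using assms(2)
  proof induction
    case (Int a b)
    then show ?case by (auto intro: eventually_conj)
  next
    case (UN K)
    then obtain V where "V \<in> K" "ppoint x \<in> V" by blast
    then show ?case
      using UN.IH[of V] by (auto elim!: eventually_mono)
  next
    case (Basis V)
    then obtain f d where f: "hom_poly J d f" and V: "V = {p \<in> pspace J. \<forall>x\<in>p. f x \<noteq> 0}"
      by blast
    from Basis.prems have "x \<noteq> (\<lambda>_. 0)" "f x \<noteq> 0"
      using hom_poly_ppoint_nonzero_iff[OF f] by (auto simp: V pspace_ppoint_iff)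
    \<comment> \<open>A constant form does not detect the zero vector, so a nonzero coordinate is
      followed separately to keep \<open>ppoint (X k)\<close> in \<open>pspace J\<close>.\<close>
    then obtain i where "x i \<noteq> 0" by auto
    then have "eventually (\<lambda>k. X k i \<noteq> 0) sequentially"
      using tendsto_imp_eventually_ne[OF X(2)] by blast
    moreover have "eventually (\<lambda>k. f (X k) \<noteq> 0) sequentially"
      by (rule tendsto_imp_eventually_ne[OF hom_poly_tendsto[OF f X(2)] \<open>f x \<noteq> 0\<close>])
    ultimately show ?case
    proof eventually_elim
      case (elim k)
      then have "X k \<noteq> (\<lambda>_. 0)" by auto
      with elim X(1) show ?case
        using hom_poly_ppoint_nonzero_iff[OF f] by (auto simp: V pspace_ppoint_iff)
    qed
  qed auto
qed

lemma zariski_closure_of_limit: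
  assumes "finite J" "ppoint x \<in> pspace J"
    and X: "\<And>k. X k \<in> coord_vecs J" "\<And>i. (\<lambda>k. X k i) \<longlonglongrightarrow> x i" "\<And>k. ppoint (X k) \<in> U"
  shows "ppoint x \<in> zariski J closure_of U"
  unfolding in_closure_of topspace_zariski[OF assms(1)]
proof (intro conjI allI impI)
  fix T assume "ppoint x \<in> T \<and> openin (zariski J) T"
  then have "eventually (\<lambda>k. ppoint (X k) \<in> T) sequentially"
    using openin_zariski_eventually X by blast
  then obtain k where "ppoint (X k) \<in> T"
    by (auto simp: eventually_sequentially)
  then show "\<exists>y. y \<in> U \<and> y \<in> T"
    using X(3) by blast
qed (rule assms(2))

text \<open>The tuple is nonzero exactly where some component is, and components outside
  \<open>K\<close> are identically 0. The locus is thus the trace on \<open>X\<close> of a union of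
  basic open sets.\<close>

lemma openin_nonvanishing:
  assumes F: "hom_tuple J K F" and X: "X \<subseteq> pspace J"
  shows "openin (subtopology (zariski J) X) (nonvanishing F X)"
proof -
  obtain d where "\<forall>k\<in>K. hom_poly J d (\<lambda>x. F x k)" and FK: "\<forall>x. F x \<in> coord_vecs K"
    using F unfolding hom_tuple_def by blast
  then have d: "\<And>k. k \<in> K \<Longrightarrow> hom_poly J d (\<lambda>x. F x k)"
    by blast
  let ?N = "\<lambda>k. {p \<in> pspace J. \<forall>x\<in>p. F x k \<noteq> 0}"
  have "nonvanishing F X = X \<inter> (\<Union>k\<in>K. ?N k)"
  proof (intro equalityI subsetI)
    fix p assume p: "p \<in> nonvanishing F X"
    then have "p \<in> pspace J"
      using X by (auto simp: nonvanishing_def)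
    then obtain x where x: "p = ppoint x"
      unfolding pspace_def by blast
    with p have "F x \<noteq> (\<lambda>_. 0)"
      by (auto simp: nonvanishing_def ppoint_nonzero_iff[OF F])
    then obtain k where "F x k \<noteq> 0" by auto
    moreover from this FK have "k \<in> K"
      by (auto simp: coord_vecs_def)
    ultimately show "p \<in> X \<inter> (\<Union>k\<in>K. ?N k)"
      using p \<open>p \<in> pspace J\<close> hom_poly_ppoint_nonzero_iff[OF d[OF \<open>k \<in> K\<close>]]
      by (auto simp: x nonvanishing_def)
  next
    fix p assume "p \<in> X \<inter> (\<Union>k\<in>K. ?N k)"
    then show "p \<in> nonvanishing F X"
      by (auto simp: nonvanishing_def)
  qed
  moreover have "openin (zariski J) (\<Union>k\<in>K. ?N k)"
    using openin_zariski_nonzero[OF d] by blast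
  ultimately show ?thesis
    by (auto simp: openin_subtopology_Int2)
qed

lemma rational_map_onI:
  assumes "hom_tuple J K F" "X \<subseteq> pspace J" "dense_open_in J X U" "U \<subseteq> nonvanishing F X"
  shows "rational_map_on J K F X"
  unfolding rational_map_on_def dense_open_in_def
proof (intro conjI)
  show "X \<subseteq> zariski J closure_of (nonvanishing F X)"
    using assms(3) closure_of_mono[OF assms(4), of "zariski J"]
    by (auto simp: dense_open_in_def)
qed (use assms(1) openin_nonvanishing[OF assms(1,2)] in auto)

text \<open>The complement is the union of the basic open sets of the defining linear forms.
  Closedness lets the linear space absorb the closure taken in
  \<open>rational_image\<close>.\<close>

lemma closedin_linear_subspace:
  assumes "finite J" "linear_subspace J W"
  shows "closedin (zariski J) W"
proof -
  obtain P where P: "\<And>f. f \<in> P \<Longrightarrow> hom_poly J 1 f"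
    and W: "W = {p \<in> pspace J. \<forall>f\<in>P. \<forall>x\<in>p. f x = 0}"
    using assms(2) unfolding linear_subspace_def by blast
  have "pspace J - W = (\<Union>f\<in>P. {p \<in> pspace J. \<forall>x\<in>p. f x \<noteq> 0})"
  proof (intro equalityI subsetI)
    fix p assume p: "p \<in> pspace J - W"
    then obtain f y where f: "f \<in> P" "y \<in> p" "f y \<noteq> 0"
      by (auto simp: W)
    from p obtain x where x: "p = ppoint x"
      unfolding pspace_def by blast
    with f have "f x \<noteq> 0"
      using hom_poly_scale[OF P[OF f(1)]] by (auto simp: ppoint_def)
    then show "p \<in> (\<Union>f\<in>P. {p \<in> pspace J. \<forall>x\<in>p. f x \<noteq> 0})"
      using f(1) p hom_poly_ppoint_nonzero_iff[OF P[OF f(1)]] by (auto simp: x)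
  next
    fix p assume p: "p \<in> (\<Union>f\<in>P. {p \<in> pspace J. \<forall>x\<in>p. f x \<noteq> 0})"
    then obtain x where "p = ppoint x"
      unfolding pspace_def by blast
    then show "p \<in> pspace J - W"
      using p ppoint_self[of x] by (auto simp: W)
  qed
  then have "openin (zariski J) (pspace J - W)"
    using openin_zariski_nonzero[OF P] by auto
  then show ?thesis
    by (auto simp: closedin_def topspace_zariski[OF assms(1)] W)
qed

lemma dense_open_inI:
  assumes "finite J" "X \<subseteq> pspace J" "hom_poly J d f" "U = {p \<in> X. \<forall>x\<in>p. f x \<noteq> 0}"
    and limit: "\<And>p. p \<in> X \<Longrightarrow> \<exists>x Y. p = ppoint x \<and> (\<forall>k. Y k \<in> coord_vecs J) \<and>
      (\<forall>i. (\<lambda>k. Y k i) \<longlonglongrightarrow> x i) \<and> (\<forall>k. ppoint (Y k) \<in> U)"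
  shows "dense_open_in J X U"
  unfolding dense_open_in_def
proof
  have "U = X \<inter> {p \<in> pspace J. \<forall>x\<in>p. f x \<noteq> 0}"
    using assms(2,4) by auto
  then show "openin (subtopology (zariski J) X) U"
    using openin_zariski_nonzero[OF assms(3)] by (simp add: openin_subtopology_Int2)
  show "X \<subseteq> zariski J closure_of U"
  proof
    fix p assume p: "p \<in> X"
    obtain x Y where "p = ppoint x" "\<forall>k. Y k \<in> coord_vecs J"
      "\<forall>i. (\<lambda>k. Y k i) \<longlonglongrightarrow> x i" "\<forall>k. ppoint (Y k) \<in> U"
      using limit[OF p] by blast
    moreover from this have "ppoint x \<in> pspace J"
      using p assms(2) by blast
    ultimately show "p \<in> zariski J closure_of U"
      using zariski_closure_of_limit[OF assms(1), of x Y U] by blast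
  qed
qed

text \<open>On \<open>U\<close> the proportionality of \<open>F\<close> and \<open>G\<close> forces the coordinate to vanish, and density
  propagates this to all of \<open>X\<close>, including points where \<open>F\<close> itself vanishes.\<close>

lemma represents_at_coordinate_zero:
  assumes dense: "dense_open_in J X U" and X: "X \<subseteq> pspace J"
    and F: "\<And>x. ppoint x \<in> U \<Longrightarrow> F x i = 0 \<and> F x j \<noteq> 0"
    and "i \<in> K" "j \<in> K" and G: "represents_at J K F X (ppoint x) G"
  shows "G x i = 0"
proof (rule ccontr)
  assume nz: "G x i \<noteq> 0"
  obtain d where d: "hom_poly J d (\<lambda>x. G x i)"
    using G \<open>i \<in> K\<close> unfolding represents_at_def hom_tuple_def by blast
  let ?N = "{p \<in> pspace J. \<forall>x\<in>p. G x i \<noteq> 0}"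
  have x: "ppoint x \<in> X"
    using G by (auto simp: represents_at_def nonvanishing_def)
  then have "ppoint x \<in> ?N"
    using X nz hom_poly_ppoint_nonzero_iff[OF d] by auto
  moreover have "ppoint x \<in> zariski J closure_of U"
    using dense x by (auto simp: dense_open_in_def)
  \<comment> \<open>The open set \<open>?N\<close> is a neighbourhood of a point in the closure of
    \<open>U\<close>, so the two meet; at a common point \<open>F y i * G y j = 0\<close>, while
    \<open>F y j * G y i\<close> is nonzero.\<close>
  ultimately have "\<exists>q. q \<in> U \<and> q \<in> ?N"
    using openin_zariski_nonzero[OF d] by (simp only: in_closure_of)
  then obtain q where q: "q \<in> U" "q \<in> ?N"
    by blast
  then obtain y where y: "q = ppoint y"
    by (auto simp: pspace_def)
  have "q \<in> X"
    using dense q(1) openin_subset unfolding dense_open_in_def by fastforce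
  then have "F y i * G y j = F y j * G y i"
    using G \<open>i \<in> K\<close> \<open>j \<in> K\<close> ppoint_self[of y] unfolding represents_at_def y by blast
  moreover have "G y i \<noteq> 0"
    using q(2) ppoint_self[of y] by (auto simp: y)
  ultimately show False
    using F[of y] q(1) by (simp add: y)
qed

section \<open>The Segre variety and the cumulant map\<close>

text \<open>The Segre parametrization with each factor normalized to \<open>[1, z i]\<close>; the
  coordinate at \<open>{}\<close> is the empty product 1.\<close>

definition segre_chart :: "nat \<Rightarrow> (nat \<Rightarrow> complex) \<Rightarrow> nat set \<Rightarrow> complex" where
  "segre_chart n z = (\<lambda>I. if I \<subseteq> {1..n} then \<Prod>i\<in>I. z i else 0)"

definition linear_chart :: "nat \<Rightarrow> (nat \<Rightarrow> complex) \<Rightarrow> nat set \<Rightarrow> complex" where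
  "linear_chart n z = (\<lambda>I. if I = {} then 1 else if I \<subseteq> {1..n} \<and> card I = 1 then \<Prod>i\<in>I. z i else 0)"

text \<open>The Segre parametrization with \<open>[y {}, y {i}]\<close> on the \<open>i\<close>-th
  factor. Using \<open>y {}\<close> instead of 1 homogenizes the inverse of the chart map: the
  component at \<open>I\<close> has degree \<open>n - card I\<close> in \<open>y {}\<close> and 1 in
  each \<open>y {i}\<close>.\<close>

definition segre_inverse :: "nat \<Rightarrow> (nat set \<Rightarrow> complex) \<Rightarrow> nat set \<Rightarrow> complex" where
  "segre_inverse n y = segre_vec n (\<lambda>i b. if b = 1 then y {i} else y {})"

definition linear_space :: "nat \<Rightarrow> (nat set \<Rightarrow> complex) set set" where
  "linear_space n =
     {p \<in> pspace (Pow {1..n}). \<forall>y\<in>p. \<forall>I. I \<subseteq> {1..n} \<and> card I \<ge> 2 \<longrightarrow> y I = 0}"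

lemma segre_vec_in_coord_vecs: "segre_vec n a \<in> coord_vecs (Pow {1..n})"
  by (auto simp: segre_vec_def coord_vecs_def)

lemma segre_chart_eq: "segre_chart n z = segre_vec n (\<lambda>i b. if b = 1 then z i else 1)"
  by (auto simp: segre_chart_def segre_vec_def fun_eq_iff)

lemma segre_inverse_linear_chart: "segre_inverse n (linear_chart n z) = segre_chart n z"
  by (auto simp: segre_inverse_def segre_chart_def segre_vec_def linear_chart_def fun_eq_iff
      intro!: prod.cong)

lemma cumulant_map_segre_chart:
  assumes L: "L \<subseteq> partitions {1..n}" and bot: "(\<lambda>i. {i}) ` {1..n} \<in> L" and top: "{{1..n}} \<in> L"
  shows "cumulant_map n L (segre_chart n z) = linear_chart n z"
proof
  fix I
  let ?Q = "restrict_poset L I"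
  show "cumulant_map n L (segre_chart n z) I = linear_chart n z I"
  proof (cases "I \<noteq> {} \<and> I \<subseteq> {1..n}")
    case False
    then show ?thesis
      by (auto simp: cumulant_map_def linear_chart_def segre_chart_def)
  next
    case True
    then have fin: "finite I" and I: "I \<noteq> {}" "I \<subseteq> {1..n}"
      using finite_subset by auto
    have Q: "?Q \<subseteq> partitions I"
      using restrict_poset_subset[OF L I(2)] .
    have "(\<Prod>B\<in>\<pi>. segre_chart n z B) = (\<Prod>i\<in>I. z i)" if "\<pi> \<in> ?Q" for \<pi>
    proof -
      have \<pi>: "partition_on I \<pi>"
        using that Q by (auto simp: partitions_def)
      then have sub: "B \<subseteq> I" if "B \<in> \<pi>" for B
        using that by (auto simp: partition_on_def)
      have "(\<Prod>B\<in>\<pi>. segre_chart n z B) = (\<Prod>B\<in>\<pi>. \<Prod>i\<in>B. z i)"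
        using sub I(2) by (intro prod.cong) (auto simp: segre_chart_def)
      \<comment> \<open>The blocks are disjoint and cover \<open>I\<close>, so every element
        contributes its factor exactly once.\<close>
      also have "\<dots> = (\<Prod>i\<in>\<Union>\<pi>. z i)"
        using \<pi> sub finite_subset[OF _ fin]
        by (subst prod.Union_disjoint) (auto simp: partition_on_def disjoint_def)
      finally show ?thesis
        using \<pi> by (simp add: partition_on_def)
    qed
    then have "cumulant_map n L (segre_chart n z) I =
        (\<Sum>\<pi>\<in>?Q. of_int (moebius I ?Q \<pi> {I}) * (\<Prod>i\<in>I. z i))"
      using I by (auto simp: cumulant_map_def segre_chart_def intro!: sum.cong)
    also have "\<dots> = of_int (\<Sum>\<pi>\<in>?Q. moebius I ?Q \<pi> {I}) * (\<Prod>i\<in>I. z i)"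
      by (simp add: sum_distrib_right)
    also have "\<dots> = linear_chart n z I"
    \<comment> \<open>On a singleton the least and greatest partitions coincide: \<open>{I}\<close>
      is the only term, with \<mu> equal to 1, and the coordinate \<open>z i\<close>
      survives.\<close>
    proof (cases "card I = 1")
      case True
      then obtain i where i: "I = {i}"
        by (auto simp: card_1_singleton_iff)
      have "?Q = {{I}}"
        using Q top_in_restrict_poset[OF top I(2,1)]
        by (auto simp: i partitions_def partition_on_singleton_iff)
      then show ?thesis
        using I i by (simp add: linear_chart_def)
    next
      case False
      then have "card I \<ge> 2"
        using I fin by (metis One_nat_def Suc_1 card_0_eq le_less less_one not_less_eq_eq not_less)
      then have "(\<Sum>\<pi>\<in>?Q. moebius I ?Q \<pi> {I}) = 0"
        using moebius_sum_top[OF fin Q] singletons_in_restrict_poset[OF bot I(2)]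
          top_in_restrict_poset[OF top I(2,1)] by blast
      then show ?thesis
        using False I by (simp add: linear_chart_def)
    qed
    finally show ?thesis .
  qed
qed

text \<open>Every monomial has degree \<open>(n - card \<pi>) + card \<pi> = n\<close>, because
  \<open>card \<pi> \<le> card I \<le> n\<close>. Blocks are nonempty, so the variable
  \<open>x {}\<close> is distinct from those in the product.\<close>

lemma hom_tuple_cumulant_map:
  assumes "L \<subseteq> partitions {1..n}"
  shows "hom_tuple (Pow {1..n}) (Pow {1..n}) (cumulant_map n L)"
  unfolding hom_tuple_def
proof (intro conjI exI[of _ n] ballI allI)
  let ?J = "Pow {1..n}"
  fix I assume I: "I \<in> ?J"
  show "hom_poly ?J n (\<lambda>x. cumulant_map n L x I)"
  proof (cases "I = {}")
    case True
    then show ?thesis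
      using hom_poly_power_times_prod[of ?J "{}" "{}" n] by (simp add: cumulant_map_def)
  next
    case False
    let ?Q = "restrict_poset L I"
    have "hom_poly ?J n (\<lambda>x. x {} ^ (n - card \<pi>) * (\<Prod>B\<in>\<pi>. x B))" if "\<pi> \<in> ?Q" for \<pi>
    proof -
      have \<pi>: "partition_on I \<pi>"
        using that restrict_poset_subset[OF assms, of I] I by (auto simp: partitions_def)
      then have "card \<pi> \<le> card I"
        using I finite_subset[of I "{1..n}"] by (intro card_partition_le) auto
      also have "\<dots> \<le> n"
        using I card_mono[of "{1..n}" I] by simp
      finally show ?thesis
        using hom_poly_power_times_prod[of ?J "{}" \<pi> "n - card \<pi>"] \<pi> I
        by (auto simp: partition_on_def)
    qed
    from hom_poly_lincomb[OF this, where k = "\<lambda>\<pi>. of_int (moebius I ?Q \<pi> {I})"]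
    show ?thesis
      using False I by (simp add: cumulant_map_def mult.assoc)
  qed
qed (auto simp: cumulant_map_def coord_vecs_def)

lemma hom_tuple_segre_inverse: "hom_tuple (Pow {1..n}) (Pow {1..n}) (segre_inverse n)"
  unfolding hom_tuple_def
proof (intro conjI exI[of _ n] ballI allI)
  let ?J = "Pow {1..n}"
  fix I assume I: "I \<in> ?J"
  let ?A = "(\<lambda>i. {i}) ` I"
  have inj: "inj_on (\<lambda>i. {i}) I"
    by simp
  have le: "card I \<le> n"
    using I card_mono[of "{1..n}" I] by simp
  have c: "card ({1..n} - I) = n - card I"
    using I finite_subset[of I "{1..n}"] by (simp add: card_Diff_subset)
  have "hom_poly ?J (n - card I + card ?A) (\<lambda>y. y {} ^ (n - card I) * (\<Prod>B\<in>?A. y B))"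
    using I by (intro hom_poly_power_times_prod) auto
  moreover have "segre_inverse n y I = y {} ^ (n - card I) * (\<Prod>B\<in>?A. y B)" for y
    using I c by (simp add: segre_inverse_def segre_vec_def prod.reindex[OF inj])
  ultimately show "hom_poly ?J n (\<lambda>y. segre_inverse n y I)"
    using le by (simp add: card_image[OF inj])
qed (simp only: segre_inverse_def segre_vec_in_coord_vecs)

section \<open>The two varieties and their affine charts\<close>

lemma segre_variety_subset: "segre_variety n \<subseteq> pspace (Pow {1..n})"
proof
  fix p assume "p \<in> segre_variety n"
  then obtain a where p: "p = ppoint (segre_vec n a)" and a: "\<And>i. i \<in> {1..n} \<Longrightarrow> (a i 0, a i 1) \<noteq> (0, 0)"
    unfolding segre_variety_def by blast
  \<comment> \<open>This index set selects a nonzero homogeneous coordinate in every factor, so the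
    Segre coordinate at it is a product of nonzero numbers.\<close>
  let ?I = "{i \<in> {1..n}. a i 1 \<noteq> 0}"
  have "(\<Prod>i\<in>?I. a i 1) \<noteq> 0"
    by (subst prod_zero_iff) auto
  moreover have "(\<Prod>i\<in>{1..n} - ?I. a i 0) \<noteq> 0"
    using a by (subst prod_zero_iff) auto
  moreover have "?I \<subseteq> {1..n}"
    by blast
  ultimately have "segre_vec n a ?I \<noteq> 0"
    unfolding segre_vec_def by simp
  then have "segre_vec n a \<noteq> (\<lambda>_. 0)"
    by metis
  then show "p \<in> pspace (Pow {1..n})"
    using segre_vec_in_coord_vecs by (simp add: p pspace_ppoint_iff)
qed

lemma linear_space_ppoint_iff:
  "ppoint y \<in> linear_space n \<longleftrightarrow> y \<in> coord_vecs (Pow {1..n}) \<and> y \<noteq> (\<lambda>_. 0) \<and>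
    (\<forall>I. I \<subseteq> {1..n} \<and> card I \<ge> 2 \<longrightarrow> y I = 0)"
  using ppoint_coordinate_zero_iff[of y] by (auto simp: linear_space_def pspace_ppoint_iff)

lemma linear_subspace_linear_space: "linear_subspace (Pow {1..n}) (linear_space n)"
  unfolding linear_subspace_def
proof (intro exI[of _ "{\<lambda>y. y I |I. I \<subseteq> {1..n} \<and> card I \<ge> 2}"] conjI)
  show "\<forall>f\<in>{\<lambda>y. y I |I. I \<subseteq> {1..n} \<and> card I \<ge> 2}. hom_poly (Pow {1..n}) 1 f"
    by (auto intro!: hom_poly_coordinate simp del: One_nat_def)
qed (auto simp: linear_space_def)

lemma segre_chart_image:
  "range (\<lambda>z. ppoint (segre_chart n z)) = {p \<in> segre_variety n. \<forall>x\<in>p. x {} \<noteq> 0}"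
proof (intro equalityI subsetI)
  fix p assume "p \<in> range (\<lambda>z. ppoint (segre_chart n z))"
  then obtain z where p: "p = ppoint (segre_chart n z)" by blast
  then have "p \<in> segre_variety n"
    unfolding segre_variety_def segre_chart_eq by (intro CollectI exI conjI) auto
  moreover have "\<forall>x\<in>p. x {} \<noteq> 0"
    by (auto simp: p ppoint_def segre_chart_def)
  ultimately show "p \<in> {p \<in> segre_variety n. \<forall>x\<in>p. x {} \<noteq> 0}" by blast
next
  fix p assume p: "p \<in> {p \<in> segre_variety n. \<forall>x\<in>p. x {} \<noteq> 0}"
  then obtain a where a: "p = ppoint (segre_vec n a)"
    unfolding segre_variety_def by blast
  \<comment> \<open>\<open>t\<close> is the coordinate at \<open>{}\<close>. It is nonzero exactly
    when all \<open>a i 0\<close> are, which permits dividing the \<open>i\<close>-th factor by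
    \<open>a i 0\<close> and the whole vector by \<open>t\<close>.\<close>
  define t where "t = (\<Prod>i\<in>{1..n}. a i 0)"
  have "segre_vec n a {} \<noteq> 0"
    using p ppoint_self by (auto simp: a)
  then have t: "t \<noteq> 0" and a0: "\<And>i. i \<in> {1..n} \<Longrightarrow> a i 0 \<noteq> 0"
    by (auto simp: segre_vec_def t_def)
  have "segre_vec n a I = t * segre_chart n (\<lambda>i. a i 1 / a i 0) I" for I
  proof (cases "I \<subseteq> {1..n}")
    case True
    then have "t = (\<Prod>i\<in>{1..n} - I. a i 0) * (\<Prod>i\<in>I. a i 0)"
      unfolding t_def by (intro prod.subset_diff) auto
    moreover have "(\<Prod>i\<in>I. a i 0) \<noteq> 0"
      using True a0 finite_subset[OF True] by (auto simp: prod_zero_iff)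
    ultimately show ?thesis
      using True by (simp add: segre_vec_def segre_chart_def prod_dividef)
  qed (simp add: segre_vec_def segre_chart_def)
  then have "segre_vec n a = (\<lambda>I. t * segre_chart n (\<lambda>i. a i 1 / a i 0) I)"
    by blast
  then have "p = ppoint (segre_chart n (\<lambda>i. a i 1 / a i 0))"
    using t by (simp add: a ppoint_scale)
  then show "p \<in> range (\<lambda>z. ppoint (segre_chart n z))" by blast
qed

lemma linear_chart_image:
  "range (\<lambda>z. ppoint (linear_chart n z)) = {p \<in> linear_space n. \<forall>y\<in>p. y {} \<noteq> 0}"
proof (intro equalityI subsetI)
  fix p assume "p \<in> range (\<lambda>z. ppoint (linear_chart n z))"
  then obtain z where p: "p = ppoint (linear_chart n z)" by blast
  have one: "linear_chart n z {} = 1"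
    by (simp add: linear_chart_def)
  then have "linear_chart n z \<noteq> (\<lambda>_. 0)"
    by (metis zero_neq_one)
  then have "p \<in> linear_space n"
    unfolding p linear_space_ppoint_iff by (auto simp: linear_chart_def coord_vecs_def)
  moreover have "\<forall>x\<in>p. x {} \<noteq> 0"
    using one by (auto simp: p ppoint_def)
  ultimately show "p \<in> {p \<in> linear_space n. \<forall>y\<in>p. y {} \<noteq> 0}" by blast
next
  fix p assume p: "p \<in> {p \<in> linear_space n. \<forall>y\<in>p. y {} \<noteq> 0}"
  then obtain y where y: "p = ppoint y"
    by (auto simp: linear_space_def pspace_def)
  have t: "y {} \<noteq> 0"
    using p ppoint_self by (auto simp: y)
  have mem: "y \<in> coord_vecs (Pow {1..n})" "\<And>I. I \<subseteq> {1..n} \<Longrightarrow> card I \<ge> 2 \<Longrightarrow> y I = 0"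
    using p by (auto simp: y linear_space_ppoint_iff)
  have "y I = y {} * linear_chart n (\<lambda>i. y {i} / y {}) I" for I
  proof (cases "I \<subseteq> {1..n}")
    case True
    then have "finite I"
      using finite_subset by blast
    then consider "I = {}" | "card I = 1" | "card I \<ge> 2"
      by (metis One_nat_def Suc_1 Suc_leI card_gt_0_iff le_neq_implies_less)
    then show ?thesis
    proof cases
      case 2
      then obtain i where "I = {i}"
        by (auto simp: card_1_singleton_iff)
      then show ?thesis
        using True t by (simp add: linear_chart_def)
    qed (use True mem in \<open>auto simp: linear_chart_def\<close>)
  next
    case False
    then show ?thesis
      using mem(1) by (auto simp: coord_vecs_def linear_chart_def)
  qed
  then have "y = (\<lambda>I. y {} * linear_chart n (\<lambda>i. y {i} / y {}) I)"
    by blast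
  then have "p = ppoint (linear_chart n (\<lambda>i. y {i} / y {}))"
    unfolding y using ppoint_scale[OF t] by metis
  then show "p \<in> range (\<lambda>z. ppoint (linear_chart n z))" by blast
qed

section \<open>Density of the charts\<close>

lemma tendsto_replace_zero:
  "(\<lambda>k. if c = 0 then inverse (of_nat (Suc k)) else c) \<longlonglongrightarrow> (c :: complex)"
proof (cases "c = 0")
  case True
  moreover have "(\<lambda>k. inverse (of_nat (Suc k)) :: complex) \<longlonglongrightarrow> 0"
    by (rule LIMSEQ_Suc[OF lim_inverse_n])
  ultimately show ?thesis
    by simp
qed simp

text \<open>The parameters are perturbed rather than the ambient coordinates, so that the
  approximating points stay on the Segre variety. Each vanishing \<open>a i 0\<close> becomes the
  reciprocal of \<open>Suc k\<close>, and the coordinates, being polynomial in the parameters,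
  converge.\<close>

lemma dense_open_segre_chart:
  "dense_open_in (Pow {1..n}) (segre_variety n) (range (\<lambda>z. ppoint (segre_chart n z)))"
proof (rule dense_open_inI[OF _ segre_variety_subset hom_poly_coordinate segre_chart_image])
  fix p assume "p \<in> segre_variety n"
  then obtain a where p: "p = ppoint (segre_vec n a)" and a: "\<And>i. i \<in> {1..n} \<Longrightarrow> (a i 0, a i 1) \<noteq> (0, 0)"
    unfolding segre_variety_def by blast
  define b where "b k i e =
    (if e = 0 then if a i 0 = 0 then inverse (of_nat (Suc k)) else a i 0 else a i e)"
    for k i and e :: nat
  have b0: "b k i 0 \<noteq> 0" for k i
    by (simp add: b_def del: of_nat_Suc)
  have b_lim: "(\<lambda>k. b k i e) \<longlonglongrightarrow> a i e" for i e
    using tendsto_replace_zero[of "a i 0"] by (cases "e = 0") (simp_all add: b_def)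
  have lim: "(\<lambda>k. segre_vec n (b k) I) \<longlonglongrightarrow> segre_vec n a I" for I
    by (cases "I \<subseteq> {1..n}") (auto simp: segre_vec_def intro!: tendsto_intros b_lim)
  have mem: "ppoint (segre_vec n (b k)) \<in> range (\<lambda>z. ppoint (segre_chart n z))" for k
  proof -
    have "segre_vec n (b k) {} \<noteq> 0"
      using b0 by (simp add: segre_vec_def)
    then have "\<forall>x\<in>ppoint (segre_vec n (b k)). x {} \<noteq> 0"
      by (auto simp: ppoint_def)
    moreover have "ppoint (segre_vec n (b k)) \<in> segre_variety n"
      using b0 unfolding segre_variety_def by blast
    ultimately show ?thesis
      unfolding segre_chart_image by blast
  qed
  show "\<exists>x Y. p = ppoint x \<and> (\<forall>k. Y k \<in> coord_vecs (Pow {1..n})) \<and> (\<forall>I. (\<lambda>k. Y k I) \<longlonglongrightarrow> x I) \<and>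
      (\<forall>k. ppoint (Y k) \<in> range (\<lambda>z. ppoint (segre_chart n z)))"
    using p lim mem segre_vec_in_coord_vecs
    by (intro exI[of _ "segre_vec n a"] exI[of _ "\<lambda>k. segre_vec n (b k)"]) blast
qed auto

text \<open>No equation of the linear space involves \<open>y {}\<close>, so perturbing this one
  coordinate reaches the chart without leaving the space.\<close>

lemma dense_open_linear_chart:
  "dense_open_in (Pow {1..n}) (linear_space n) (range (\<lambda>z. ppoint (linear_chart n z)))"
proof (rule dense_open_inI[OF _ _ hom_poly_coordinate linear_chart_image])
  fix p assume p: "p \<in> linear_space n"
  then obtain y where y: "p = ppoint y"
    by (auto simp: linear_space_def pspace_def)
  define Y where "Y k I = (if I = {} then if y {} = 0 then inverse (of_nat (Suc k)) else y {} else y I)"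
    for k I
  have Y0: "Y k {} \<noteq> 0" for k
    by (simp add: Y_def del: of_nat_Suc)
  have lim: "(\<lambda>k. Y k I) \<longlonglongrightarrow> y I" for I
    using tendsto_replace_zero[of "y {}"] by (cases "I = {}") (simp_all add: Y_def)
  have coord: "Y k \<in> coord_vecs (Pow {1..n})" for k
    using p by (auto simp: y linear_space_ppoint_iff coord_vecs_def Y_def)
  have "Y k \<noteq> (\<lambda>_. 0)" for k
    using Y0 by metis
  then have "ppoint (Y k) \<in> linear_space n" for k
    using coord p by (auto simp: y linear_space_ppoint_iff Y_def)
  moreover have "\<forall>x\<in>ppoint (Y k). x {} \<noteq> 0" for k
    using Y0 by (auto simp: ppoint_def)
  ultimately have "ppoint (Y k) \<in> range (\<lambda>z. ppoint (linear_chart n z))" for k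
    unfolding linear_chart_image by blast
  then show "\<exists>x Y. p = ppoint x \<and> (\<forall>k. Y k \<in> coord_vecs (Pow {1..n})) \<and> (\<forall>I. (\<lambda>k. Y k I) \<longlonglongrightarrow> x I) \<and>
      (\<forall>k. ppoint (Y k) \<in> range (\<lambda>z. ppoint (linear_chart n z)))"
    using y lim coord by blast
qed (auto simp: linear_space_def)

theorem theorem5p8:
  fixes n :: nat and L :: "nat set set set"
  assumes "n \<ge> 1"
    and "L \<subseteq> partitions {1..n}"
    and "(\<lambda>i. {i}) ` {1..n} \<in> L"
    and "{{1..n}} \<in> L"
  shows "linearizes (Pow {1..n}) (cumulant_map n L) (segre_variety n) \<and>
    rational_image (Pow {1..n}) (Pow {1..n}) (cumulant_map n L) (segre_variety n) =
      {p \<in> pspace (Pow {1..n}). \<forall>y\<in>p. \<forall>I. I \<subseteq> {1..n} \<and> card I \<ge> 2 \<longrightarrow> y I = 0}"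
proof -
  let ?J = "Pow {1..n}" and ?F = "cumulant_map n L" and ?G = "segre_inverse n"
  let ?X = "segre_variety n" and ?W = "linear_space n"
  let ?U = "range (\<lambda>z. ppoint (segre_chart n z))" and ?V = "range (\<lambda>z. ppoint (linear_chart n z))"
  have F: "hom_tuple ?J ?J ?F" and G: "hom_tuple ?J ?J ?G"
    using hom_tuple_cumulant_map[OF assms(2)] hom_tuple_segre_inverse by auto
  have Fz: "?F (segre_chart n z) = linear_chart n z" for z
    using cumulant_map_segre_chart[OF assms(2-4)] .
  have Fp: "pmap ?F (ppoint (segre_chart n z)) = ppoint (linear_chart n z)" for z
    by (simp add: pmap_ppoint[OF F] Fz)
  have Gp: "pmap ?G (ppoint (linear_chart n z)) = ppoint (segre_chart n z)" for z
    by (simp add: pmap_ppoint[OF G] segre_inverse_linear_chart)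
  have chart_nz: "segre_chart n z \<noteq> (\<lambda>_. 0)" "linear_chart n z \<noteq> (\<lambda>_. 0)" for z
    by (auto simp: segre_chart_def linear_chart_def fun_eq_iff intro!: exI[of _ "{}"])
  have U: "?U \<subseteq> nonvanishing ?F ?X"
  proof (rule image_subsetI)
    fix z
    have "ppoint (segre_chart n z) \<in> ?X"
      using segre_chart_image by blast
    then show "ppoint (segre_chart n z) \<in> nonvanishing ?F ?X"
      using chart_nz by (simp add: nonvanishing_def ppoint_nonzero_iff[OF F] Fz)
  qed
  have V: "?V \<subseteq> nonvanishing ?G ?W"
  proof (rule image_subsetI)
    fix z
    have "ppoint (linear_chart n z) \<in> ?W"
      using linear_chart_image by blast
    then show "ppoint (linear_chart n z) \<in> nonvanishing ?G ?W"
      using chart_nz by (simp add: nonvanishing_def ppoint_nonzero_iff[OF G] segre_inverse_linear_chart)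
  qed
  have W: "?W \<subseteq> pspace ?J"
    by (auto simp: linear_space_def)
  have closed: "closedin (zariski ?J) ?W"
    by (intro closedin_linear_subspace linear_subspace_linear_space) simp
  have Frat: "rational_map_on ?J ?J ?F ?X"
    by (rule rational_map_onI[OF F segre_variety_subset dense_open_segre_chart U])
  have Grat: "rational_map_on ?J ?J ?G ?W"
    by (rule rational_map_onI[OF G W dense_open_linear_chart V])
  have "birational_onto ?J ?J ?F ?X ?W"
    unfolding birational_onto_def
    by (rule conjI[OF Frat], rule exI[of _ ?G], rule exI[of _ ?U], rule exI[of _ ?V],
        intro conjI Grat dense_open_segre_chart dense_open_linear_chart U V) (auto simp: Fp Gp)
  then have "linearizes ?J ?F ?X"
    using linear_subspace_linear_space unfolding linearizes_def by blast
  moreover have "rational_image ?J ?J ?F ?X = ?W"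
    unfolding rational_image_def
  proof
    let ?S = "{pmap G p |G p. p \<in> ?X \<and> represents_at ?J ?J ?F ?X p G}"
    \<comment> \<open>The tuple \<open>G\<close> is arbitrary and may be the only one defined at
      \<open>p\<close>. Proportionality to the cumulant map is used on the dense chart, with
      \<open>{}\<close> as the coordinate of comparison because the cumulant map is nonzero
      there.\<close>
    have "?S \<subseteq> ?W"
    proof
      fix q assume "q \<in> ?S"
      then obtain G p where q: "q = pmap G p" "p \<in> ?X" and rep: "represents_at ?J ?J ?F ?X p G"
        by blast
      then obtain x where x: "p = ppoint x"
        by (auto simp: segre_variety_def)
      have H: "hom_tuple ?J ?J G" and nz: "G x \<noteq> (\<lambda>_. 0)"
        using rep ppoint_self by (auto simp: represents_at_def nonvanishing_def x)
      have "G x I = 0" if I: "I \<subseteq> {1..n}" "card I \<ge> 2" for I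
      proof (rule represents_at_coordinate_zero[where F = ?F and G = G and x = x and j = "{}",
            OF dense_open_segre_chart segre_variety_subset])
        show "represents_at ?J ?J ?F ?X (ppoint x) G"
          using rep by (simp add: x)
        fix w assume "ppoint w \<in> ?U"
        then obtain z where z: "ppoint w = ppoint (segre_chart n z)" by blast
        \<comment> \<open>The vector \<open>w\<close> is only a scalar multiple of the normalized
          one, so \<open>?F w\<close> is known up to a nonzero factor; this suffices for which
          coordinates vanish.\<close>
        have "ppoint (?F w) = ppoint (linear_chart n z)"
          using pmap_ppoint[OF F, of w] by (simp add: z Fp)
        then have "?F w \<in> ppoint (linear_chart n z)"
          using ppoint_self by blast
        then show "?F w I = 0 \<and> ?F w {} \<noteq> 0"
          using I by (auto simp: ppoint_def linear_chart_def)
      qed (use I in auto)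
      then show "q \<in> ?W"
        using H nz by (auto simp: q x pmap_ppoint[OF H] linear_space_ppoint_iff hom_tuple_def)
    qed
    then show "zariski ?J closure_of ?S \<subseteq> ?W"
      using closed by (rule closure_of_minimal)
    \<comment> \<open>On the chart the cumulant map represents itself, so its values there already
      lie in the image before closure; as these values are dense in the linear space, the closure
      contains all of it.\<close>
    have "?V \<subseteq> ?S"
    proof
      fix q assume "q \<in> ?V"
      then obtain z where z: "q = pmap ?F (ppoint (segre_chart n z))"
        by (auto simp: Fp)
      have nv: "ppoint (segre_chart n z) \<in> nonvanishing ?F ?X"
        using U by blast
      then have "represents_at ?J ?J ?F ?X (ppoint (segre_chart n z)) ?F"
        using F by (simp add: represents_at_def mult.commute)
      then show "q \<in> ?S"
        using nv unfolding z nonvanishing_def by blast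
    qed
    then have "zariski ?J closure_of ?V \<subseteq> zariski ?J closure_of ?S"
      by (rule closure_of_mono)
    then show "?W \<subseteq> zariski ?J closure_of ?S"
      using dense_open_linear_chart unfolding dense_open_in_def by blast
  qed
  ultimately show ?thesis
    by (simp add: linear_space_def)
qed

end
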